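(* Let $B$ be an algebra over a field $K$ and let $\alpha,\beta,\gamma\in\mathrm{Mul}[[B]]$. Then: (i) the formal product is associative: $(\alpha\beta)\gamma=\alpha(\beta\gamma)$; (ii) distributivity holds: $(\alpha+\beta)\gamma=\alpha\gamma+\beta\gamma$ and $\alpha(\beta+\gamma)=\alpha\beta+\alpha\gamma$; (iii) the element $1=(1,0,0,\ldots)\in\mathrm{Mul}[[B]]$ is a multiplicative identity element; (iv) an element $\alpha=(\alpha_0,\alpha_1,\ldots)\in\mathrm{Mul}[[B]]$ has a multiplicative inverse if and only if $\alpha_0$ is an invertible element of $\widetilde B$; (v) formal composition is associative: if $\beta_0=0$ and $\gamma_0=0$, then $(\alpha\circ\beta)\circ\gamma=\alpha\circ(\beta\circ\gamma)$; (vi) if $\gamma_0=0$, then $(\alpha+\beta)\circ\gamma=\alpha\circ\gamma+\beta\circ\gamma$ and $(\alpha\beta)\circ\gamma=(\alpha\circ\gamma)(\beta\circ\gamma)$; (vii) the element $I=(0,\mathrm{id}_B,0,0,\ldots)\in\mathrm{Mul}[[B]]$ is an identity element for the (partially defined) operation of composition; (viii) an element $\alpha=(0,\alpha_1,\alpha_2,\ldots)\in\mathrm{Mul}[[B]]$ has an inverse with respect to formal composition, denoted $\alpha^{\langle-1\rangle}$, if and only if $\alpha_1$ is an invertible element of $\mathcal L(B)$.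
   Context: $\widetilde B$ equals $B$ if $B$ has an identity element and the unitization of $B$ otherwise; $1$ denotes its identity. $\mathcal L(B)$ is the algebra of linear maps $B\to B$. $\mathrm{Mul}[[B]]$ is the set of sequences $\alpha=(\alpha_0,\alpha_1,\alpha_2,\ldots)$ with $\alpha_0\in\widetilde B$ and, for $n\ge1$, $\alpha_n:B\times\cdots\times B\to B$ an $n$-multilinear ($K$-multilinear) map. The sum is $(\alpha+\beta)_n=\alpha_n+\beta_n$. The formal product is $(\alpha\beta)_0=\alpha_0\beta_0$ and, for $n\ge1$, $(\alpha\beta)_n(b_1,\ldots,b_n)=\sum_{k=0}^n\alpha_k(b_1,\ldots,b_k)\beta_{n-k}(b_{k+1},\ldots,b_n)$. If $\beta_0=0$, the formal composition $\alpha\circ\beta$ (defined only in this case) is given by $(\alpha\circ\beta)_0=\alpha_0$ and, for $n\ge1$, $$(\alpha\circ\beta)_n(b_1,\ldots,b_n)=\sum_{k=1}^n\ \sum_{\substack{p_1,\ldots,p_k\ge1 \\ p_1+\cdots+p_k=n}}\alpha_k\big(\beta_{p_1}(b_{q_1+1},\ldots,b_{q_1+p_1}),\ldots,\beta_{p_k}(b_{q_k+1},\ldots,b_{q_k+p_k})\big),$$ where $q_j=p_1+\cdots+p_{j-1}$ (so $q_1=0$). Inverses (multiplicative or with respect to composition) are two-sided. *)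

theory Defs
  imports Complex_Main "HOL-Library.Product_Plus"
begin

text \<open>Associative algebras over a field, neither unital nor commutative in general
  (class \<open>ring\<close> has no identity element).\<close>

locale algebra_over_field = vector_space scale
  for scale :: "'k::field \<Rightarrow> 'b::ring \<Rightarrow> 'b" +
  assumes scale_mult_left: "scale c x * y = scale c (x * y)"
    and scale_mult_right: "x * scale c y = scale c (x * y)"

definition is_identity :: "'b::ring \<Rightarrow> bool" where
  "is_identity e \<longleftrightarrow> (\<forall>b. e * b = b \<and> b * e = b)"

text \<open>
  The unitization of \<open>B\<close> is \<open>K \<oplus> B\<close>, the pair \<open>(c, x)\<close> standing for \<open>c 1 + x\<close>.
  To treat both cases of the definition of \<open>B~\<close> inside the one type \<open>'k \<times> 'b\<close>, the algebra
  \<open>B\<close> itself is represented by its copy \<open>{0} \<times> B\<close>, on which the product below is that of \<open>B\<close>.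
  Thus \<open>b \<in> B\<close> is identified with \<open>(0, b) \<in> B~\<close> in either case.
\<close>

definition tilde :: "('k::field \<times> 'b::ring) set" where
  "tilde = (if \<exists>e::'b. is_identity e then {0} \<times> UNIV else UNIV)"

definition tilde_one :: "'k::field \<times> 'b::ring" where
  "tilde_one = (if \<exists>e::'b. is_identity e then (0, THE e. is_identity e) else (1, 0))"

definition tilde_mult ::
    "('k::field \<Rightarrow> 'b::ring \<Rightarrow> 'b) \<Rightarrow> 'k \<times> 'b \<Rightarrow> 'k \<times> 'b \<Rightarrow> 'k \<times> 'b" where
  "tilde_mult scale u v =
     (fst u * fst v, scale (fst u) (snd v) + scale (fst v) (snd u) + snd u * snd v)"

text \<open>
  A sequence \<open>(\<alpha>\<^sub>0, \<alpha>\<^sub>1, \<dots>)\<close> is a single function on lists: \<open>\<alpha> []\<close> is \<open>\<alpha>\<^sub>0 \<in> B~\<close>, and for \<open>n \<ge> 1\<close>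
  \<open>\<alpha> [b\<^sub>1, \<dots>, b\<^sub>n]\<close> is \<open>\<alpha>\<^sub>n(b\<^sub>1, \<dots>, b\<^sub>n) \<in> B\<close>, seen as an element \<open>(0, b)\<close> of \<open>B~\<close>.
  Equality of such functions is equality of all the components.
\<close>

type_synonym ('k, 'b) series = "'b list \<Rightarrow> 'k \<times> 'b"

definition Mul :: "('k::field \<Rightarrow> 'b::ring \<Rightarrow> 'b) \<Rightarrow> ('k, 'b) series set" where
  "Mul scale = {\<alpha>. \<alpha> [] \<in> tilde \<and>
     (\<forall>bs. bs \<noteq> [] \<longrightarrow> fst (\<alpha> bs) = 0) \<and>
     (\<forall>bs i. i < length bs \<longrightarrow> Vector_Spaces.linear scale scale (\<lambda>x. snd (\<alpha> (bs[i := x]))))}"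

definition series_add ::
    "('k::field, 'b::ring) series \<Rightarrow> ('k, 'b) series \<Rightarrow> ('k, 'b) series" where
  "series_add \<alpha> \<beta> = (\<lambda>bs. \<alpha> bs + \<beta> bs)"

definition series_mult ::
    "('k::field \<Rightarrow> 'b::ring \<Rightarrow> 'b) \<Rightarrow> ('k, 'b) series \<Rightarrow> ('k, 'b) series \<Rightarrow> ('k, 'b) series" where
  "series_mult scale \<alpha> \<beta> =
     (\<lambda>bs. \<Sum>k=0..length bs. tilde_mult scale (\<alpha> (take k bs)) (\<beta> (drop k bs)))"

definition series_one :: "('k::field, 'b::ring) series" where
  "series_one = (\<lambda>bs. if bs = [] then tilde_one else 0)"

definition compositions :: "nat \<Rightarrow> nat \<Rightarrow> nat list set" where
  "compositions n k = {ps. length ps = k \<and> (\<forall>p\<in>set ps. 1 \<le> p) \<and> sum_list ps = n}"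

text \<open>
  Only meaningful if \<open>\<beta> [] = 0\<close>. The index \<open>j\<close> starts at \<open>0\<close>, so \<open>sum_list (take j ps)\<close> is the
  offset of the block of \<open>bs\<close> of length \<open>ps ! j\<close>.
\<close>

definition series_comp ::
    "('k::field, 'b::ring) series \<Rightarrow> ('k, 'b) series \<Rightarrow> ('k, 'b) series" where
  "series_comp \<alpha> \<beta> = (\<lambda>bs. if bs = [] then \<alpha> [] else
     \<Sum>k=1..length bs. \<Sum>ps\<in>compositions (length bs) k.
       \<alpha> (map (\<lambda>j. snd (\<beta> (take (ps ! j) (drop (sum_list (take j ps)) bs)))) [0..<k]))"

definition series_id :: "('k::field, 'b::ring) series" where
  "series_id = (\<lambda>bs. case bs of [b] \<Rightarrow> (0, b) | _ \<Rightarrow> 0)"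

text \<open>The algebra of linear maps \<open>B \<rightarrow> B\<close>, with composition as product and \<open>id\<close> as identity.\<close>

definition linear_maps :: "('k::field \<Rightarrow> 'b::ring \<Rightarrow> 'b) \<Rightarrow> ('b \<Rightarrow> 'b) set" where
  "linear_maps scale = {f. Vector_Spaces.linear scale scale f}"

end

theory Submission
  imports Defs
begin

text \<open>
  Every sum in sight is a sum over ways of cutting up the list of arguments. The product at \<open>bs\<close> is
  the sum over all pairs \<open>(us, vs)\<close> with \<open>us @ vs = bs\<close>, and the composition \<open>\<alpha> \<circ> \<beta>\<close> at \<open>bs\<close> is the
  sum, over all lists \<open>xss\<close> of nonempty lists with concatenation \<open>bs\<close>, of \<open>\<alpha>\<close> at the list of values
  of \<open>\<beta>\<close> on the blocks (\<open>series_comp_eq_sum_splittings\<close>). Block lengths and offsets disappear,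
  and the identities become bijections between index sets:

  \<^item> for the associativity of the product, two ways to write \<open>bs = u @ v @ w\<close> as a nested cut;
  \<^item> for \<open>(\<alpha>\<beta>) \<circ> \<gamma>\<close>, cutting a list of blocks in two versus cutting \<open>bs\<close> in two and then each part
    into blocks;
  \<^item> for the associativity of composition, a list \<open>C\<close> of lists of blocks, seen either as a grouping
    of the blocks \<open>concat C\<close> of \<open>bs\<close>, or as a refinement of the coarser blocks \<open>map concat C\<close>. The
    second reading arises after expanding a value of \<open>\<alpha>\<close> at a list of sums, which is where
    associativity needs \<open>\<alpha>\<close> to be multilinear (\<open>multiadditive_expansion\<close>).

  If a sequence has an inverse, reading off the first relevant component inverts \<open>\<alpha>\<^sub>0\<close>, respectively
  \<open>\<alpha>\<^sub>1\<close>. Conversely, suppose that this term is invertible. In \<open>\<alpha>\<delta> = 1\<close> the component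
  at \<open>bs\<close> reads \<open>\<alpha>\<^sub>0 \<delta>(bs) + \<dots> = 1(bs)\<close>, and in \<open>\<alpha> \<circ> \<delta> = I\<close> it reads \<open>\<alpha>\<^sub>1(\<delta>(bs)) + \<dots> = I(bs)\<close>,
  where the omitted terms involve \<open>\<delta>\<close> on shorter lists only. So both equations can be solved for
  \<open>\<delta>\<close> by recursion on the length of the list, and the solution is multilinear by induction along that
  recursion. This produces right inverses only, but the leading term of \<open>\<delta>\<close> is again invertible, so
  \<open>\<delta>\<close> has a right inverse \<open>\<epsilon>\<close> too, and associativity gives \<open>\<alpha> = \<alpha>(\<delta>\<epsilon>) = (\<alpha>\<delta>)\<epsilon> = \<epsilon>\<close>: the right
  inverse is two-sided.
\<close>

section \<open>Cutting and splitting lists\<close>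

definition cuts :: "'a list \<Rightarrow> ('a list \<times> 'a list) set" where
  "cuts xs = {(us, vs). us @ vs = xs}"

definition splittings :: "'a list \<Rightarrow> 'a list list set" where
  "splittings xs = {xss. concat xss = xs \<and> [] \<notin> set xss}"

lemma mem_cuts [simp]: "(us, vs) \<in> cuts xs \<longleftrightarrow> us @ vs = xs"
  by (simp add: cuts_def)

lemma bij_betw_cuts: "bij_betw (\<lambda>k. (take k xs, drop k xs)) {0..length xs} (cuts xs)"
  by (rule bij_betw_byWitness[where f' = "\<lambda>(us, vs). length us"]) (auto simp: cuts_def)

lemma finite_cuts [simp]: "finite (cuts xs)"
  using bij_betw_finite[OF bij_betw_cuts] by blast

lemma length_le_length_concat: "[] \<notin> set xss \<Longrightarrow> length xss \<le> length (concat xss)"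
proof (induction xss)
  case (Cons x xss)
  then show ?case by (cases x) auto
qed simp

lemma concat_map_concat: "concat (map concat xsss) = concat (concat xsss)"
  by (induction xsss) simp_all

lemma finite_splittings [simp]: "finite (splittings xs)"
proof (rule finite_subset)
  let ?A = "{ys. set ys \<subseteq> set xs \<and> length ys \<le> length xs}"
  show "splittings xs \<subseteq> {xss. set xss \<subseteq> ?A \<and> length xss \<le> length xs}"
  proof
    fix xss assume "xss \<in> splittings xs"
    then have c: "concat xss = xs" and n: "[] \<notin> set xss" by (auto simp: splittings_def)
    have "length ys \<le> length xs" if "ys \<in> set xss" for ys
      using split_list[OF that] c by auto
    with c length_le_length_concat[OF n]
    show "xss \<in> {xss. set xss \<subseteq> ?A \<and> length xss \<le> length xs}" by auto
  qed
  show "finite {xss. set xss \<subseteq> ?A \<and> length xss \<le> length xs}"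
    by (intro finite_lists_length_le) simp_all
qed

lemma splittings_Nil [simp]: "splittings [] = {[]}"
proof -
  have "xss = []" if "concat xss = []" "[] \<notin> set xss" for xss :: "'a list list"
    using that by (cases xss) auto
  then show ?thesis by (auto simp: splittings_def)
qed

lemma eq_if_concat_eq_and_lengths_eq:
  assumes "map length xss = map length yss" and "concat xss = concat yss"
  shows "xss = yss"
proof -
  have "length xss = length yss" using assms(1) by (rule map_eq_imp_length_eq)
  then show ?thesis using assms by (induction xss yss rule: list_induct2) auto
qed

lemma ex_concat_with_lengths:
  "sum_list ps = length xs \<Longrightarrow> \<exists>xss. map length xss = ps \<and> concat xss = xs"
proof (induction ps arbitrary: xs)
  case (Cons p ps)
  then have "sum_list ps = length (drop p xs)" by simp
  from Cons.IH[OF this] obtain xss where "map length xss = ps" "concat xss = drop p xs" by blast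
  with Cons.prems have "map length (take p xs # xss) = p # ps \<and> concat (take p xs # xss) = xs"
    by simp
  then show ?case by (rule exI)
qed simp

lemma block_of_concat:
  assumes "j < length xss"
  shows "take (length (xss ! j)) (drop (sum_list (take j (map length xss))) (concat xss)) = xss ! j"
proof -
  have "concat xss = concat (take j xss @ xss ! j # drop (Suc j) xss)"
    using id_take_nth_drop[OF assms] by simp
  moreover have "sum_list (take j (map length xss)) = length (concat (take j xss))"
    by (simp add: length_concat take_map)
  ultimately show ?thesis by simp
qed

text \<open>
  The composition of \<open>n\<close> attached to a splitting is the list of its block lengths. The blocks are
  recovered from these lengths, so nothing is lost.
\<close>

lemma bij_betw_splittings_compositions:
  "bij_betw (map length) {xss \<in> splittings xs. length xss = k} (compositions (length xs) k)"
  unfolding bij_betw_def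
proof
  show "inj_on (map length) {xss \<in> splittings xs. length xss = k}"
    by (intro inj_onI eq_if_concat_eq_and_lengths_eq) (auto simp: splittings_def)
  show "map length ` {xss \<in> splittings xs. length xss = k} = compositions (length xs) k"
  proof (intro equalityI subsetI)
    fix ps assume "ps \<in> map length ` {xss \<in> splittings xs. length xss = k}"
    then show "ps \<in> compositions (length xs) k"
      by (auto simp: compositions_def splittings_def length_concat Suc_le_eq)
  next
    fix ps assume ps: "ps \<in> compositions (length xs) k"
    then obtain xss where xss: "map length xss = ps" "concat xss = xs"
      using ex_concat_with_lengths[of ps xs] by (auto simp: compositions_def)
    have "[] \<notin> set xss"
    proof
      assume "[] \<in> set xss"
      then have "0 \<in> set ps" using xss(1) by force
      then show False using ps by (auto simp: compositions_def)
    qed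
    moreover have "length xss = k" using ps xss(1) by (auto simp: compositions_def)
    ultimately show "ps \<in> map length ` {xss \<in> splittings xs. length xss = k}"
      using xss by (auto simp: splittings_def image_iff)
  qed
qed

text \<open>
  A splitting is a matter of positions, not of entries. Even where \<open>f\<close> identifies entries, distinct
  splittings stay distinct: \<open>map (map f)\<close> preserves the block lengths, which determine a splitting of
  a given list.
\<close>

lemma bij_betw_splittings_map:
  "bij_betw (map (map f)) (splittings xs) (splittings (map f xs))"
  unfolding bij_betw_def
proof
  show "inj_on (map (map f)) (splittings xs)"
  proof (intro inj_onI eq_if_concat_eq_and_lengths_eq)
    fix xss yss assume "map (map f) xss = map (map f) yss"
    then have "map length (map (map f) xss) = map length (map (map f) yss)" by simp
    then show "map length xss = map length yss" by (simp add: comp_def)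
  qed (auto simp: splittings_def)
  show "map (map f) ` splittings xs = splittings (map f xs)"
  proof (intro equalityI subsetI)
    fix yss assume "yss \<in> map (map f) ` splittings xs"
    then show "yss \<in> splittings (map f xs)" by (auto simp: splittings_def map_concat)
  next
    fix yss assume "yss \<in> splittings (map f xs)"
    then have c: "concat yss = map f xs" and n: "[] \<notin> set yss" by (auto simp: splittings_def)
    have "sum_list (map length yss) = length xs" using c by (metis length_concat length_map)
    then obtain xss where xss: "map length xss = map length yss" "concat xss = xs"
      using ex_concat_with_lengths by blast
    have "map (map f) xss = yss"
      by (rule eq_if_concat_eq_and_lengths_eq)
        (use xss c in \<open>simp_all add: comp_def flip: map_concat\<close>)
    moreover from this have "[] \<notin> set xss" using n by force
    ultimately show "yss \<in> map (map f) ` splittings xs"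
      using xss(2) by (auto simp: splittings_def image_iff)
  qed
qed

lemma singleton_mem_splittings: "xs \<noteq> [] \<Longrightarrow> [xs] \<in> splittings xs"
  by (simp add: splittings_def)

lemma splittings_length_less_2:
  assumes "xss \<in> splittings xs" "xs \<noteq> []" "length xss < 2"
  shows "xss = [xs]"
  using assms by (cases xss rule: remdups_adj.cases) (auto simp: splittings_def)

text \<open>This makes the recursion that defines compositional inverses terminate.\<close>

lemma block_shorter:
  assumes "xss \<in> splittings xs" "2 \<le> length xss" "ys \<in> set xss"
  shows "length ys < length xs"
proof -
  obtain us vs where e: "xss = us @ ys # vs" using split_list[OF assms(3)] by blast
  have "[] \<notin> set (us @ vs)" "us @ vs \<noteq> []" using assms(1,2) by (auto simp: e splittings_def)
  then have "0 < length (concat (us @ vs))" using length_le_length_concat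
    by (metis length_greater_0_conv less_le_trans)
  moreover have "length xs = length ys + length (concat (us @ vs))"
    using assms(1) by (auto simp: e splittings_def)
  ultimately show ?thesis by simp
qed

text \<open>
  To refine each block of \<open>xss\<close> is to give a list of lists of blocks, which determines \<open>xss\<close>: it is
  the list of the concatenations.
\<close>

lemma mem_listset_splittings:
  "yss \<in> listset (map splittings xss) \<longleftrightarrow>
    map concat yss = xss \<and> (\<forall>ys\<in>set yss. [] \<notin> set ys)"
proof (induction xss arbitrary: yss)
  case (Cons xs xss)
  then show ?case by (cases yss) (auto simp: set_Cons_def splittings_def)
qed auto

lemma finite_listset_map: "(\<And>x. finite (S x)) \<Longrightarrow> finite (listset (map S xs))"
proof (induction xs)
  case (Cons x xs)
  have "set_Cons A B = (\<lambda>(y, ys). y # ys) ` (A \<times> B)" for A :: "'b set" and B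
    by (auto simp: set_Cons_def)
  with Cons show ?case by simp
qed simp

section \<open>Product and composition as sums over cuts and splittings\<close>

lemma series_mult_eq_sum_cuts:
  "series_mult scale \<alpha> \<beta> bs = (\<Sum>(us, vs)\<in>cuts bs. tilde_mult scale (\<alpha> us) (\<beta> vs))"
  unfolding series_mult_def by (simp add: sum.reindex_bij_betw[OF bij_betw_cuts, symmetric])

lemma series_comp_eq_sum_splittings:
  "series_comp \<alpha> \<beta> bs = (\<Sum>xss\<in>splittings bs. \<alpha> (map (\<lambda>xs. snd (\<beta> xs)) xss))"
proof (cases "bs = []")
  case False
  let ?S = "\<lambda>k. {xss \<in> splittings bs. length xss = k}"
  have block: "map (\<lambda>j. snd (\<beta> (take (map length xss ! j)
        (drop (sum_list (take j (map length xss))) bs)))) [0..<k] = map (\<lambda>xs. snd (\<beta> xs)) xss"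
    if "xss \<in> ?S k" for k xss
    using that block_of_concat[of _ xss] by (auto intro!: nth_equalityI simp: splittings_def)
  have inner: "(\<Sum>ps\<in>compositions (length bs) k.
        \<alpha> (map (\<lambda>j. snd (\<beta> (take (ps ! j) (drop (sum_list (take j ps)) bs)))) [0..<k])) =
      (\<Sum>xss\<in>?S k. \<alpha> (map (\<lambda>xs. snd (\<beta> xs)) xss))" for k
    by (subst sum.reindex_bij_betw[OF bij_betw_splittings_compositions, symmetric])
      (intro sum.cong refl arg_cong[where f = \<alpha>] block)
  have "series_comp \<alpha> \<beta> bs = (\<Sum>k=1..length bs. \<Sum>xss\<in>?S k. \<alpha> (map (\<lambda>xs. snd (\<beta> xs)) xss))"
    using False by (simp only: series_comp_def inner if_False)
  also have "\<dots> = (\<Sum>xss\<in>splittings bs. \<alpha> (map (\<lambda>xs. snd (\<beta> xs)) xss))"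
  proof (rule sum.group)
    show "length ` splittings bs \<subseteq> {1..length bs}"
    proof
      fix k assume "k \<in> length ` splittings bs"
      then obtain xss where k: "k = length xss" and c: "concat xss = bs" and n: "[] \<notin> set xss"
        by (auto simp: splittings_def)
      from c False have "xss \<noteq> []" by auto
      with k c length_le_length_concat[OF n] show "k \<in> {1..length bs}"
        by (auto simp: Suc_le_eq)
    qed
  qed simp_all
  finally show ?thesis .
qed (simp add: series_comp_def)

lemma sum_splittings_map:
  "(\<Sum>yss\<in>splittings (map f xs). h yss) = (\<Sum>xss\<in>splittings xs. h (map (map f) xss))"
  using sum.reindex_bij_betw[OF bij_betw_splittings_map] by metis

lemma sum_long_splittings_map:
  "(\<Sum>yss | yss \<in> splittings (map f xs) \<and> k \<le> length yss. h yss) =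
    (\<Sum>xss | xss \<in> splittings xs \<and> k \<le> length xss. h (map (map f) xss))"
  by (simp add: sum.inter_filter sum_splittings_map)

lemma series_mult_Nil: "series_mult scale \<alpha> \<beta> [] = tilde_mult scale (\<alpha> []) (\<beta> [])"
  by (simp add: series_mult_def)

lemma series_comp_Nil: "series_comp \<alpha> \<beta> [] = \<alpha> []"
  by (simp add: series_comp_def)

lemma splittings_single: "splittings [b] = {[[b]]}"
proof -
  have "xss = [[b]]" if "xss \<in> splittings [b]" for xss
    using that length_le_length_concat[of xss]
    by (intro splittings_length_less_2) (auto simp: splittings_def)
  then show ?thesis using singleton_mem_splittings[of "[b]"] by blast
qed

lemma series_comp_single: "series_comp \<alpha> \<beta> [b] = \<alpha> [snd (\<beta> [b])]"
  by (simp add: series_comp_eq_sum_splittings splittings_single)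

lemma series_id_simps [simp]:
  "series_id [] = 0" "series_id [b] = (0, b)" "series_id (b # c # bs) = 0"
  by (simp_all add: series_id_def)

lemma series_id_eq_zero: "length bs \<noteq> 1 \<Longrightarrow> series_id bs = 0"
  by (cases bs rule: remdups_adj.cases) auto

section \<open>The algebra obtained by adjoining an identity\<close>

lemma fst_tilde_mult [simp]: "fst (tilde_mult scale u v) = fst u * fst v"
  by (simp add: tilde_mult_def)

lemma embedded_mem_tilde: "fst z = 0 \<Longrightarrow> z \<in> tilde"
  by (cases z) (auto simp: tilde_def)

lemma zero_mem_tilde: "0 \<in> tilde"
  by (simp add: embedded_mem_tilde)

lemma diff_mem_tilde: "u \<in> tilde \<Longrightarrow> v \<in> tilde \<Longrightarrow> u - v \<in> tilde"
  by (auto simp: tilde_def split: if_splits)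

lemma is_identity_the: "is_identity (e::'b::ring) \<Longrightarrow> is_identity (THE e::'b. is_identity e)"
  by (rule theI[of is_identity e]) (assumption, metis is_identity_def)

lemma tilde_one_mem_tilde: "tilde_one \<in> tilde"
  by (simp add: tilde_one_def tilde_def)

context algebra_over_field
begin

abbreviation tmult (infixl "\<odot>" 70) where "u \<odot> v \<equiv> tilde_mult scale u v"

lemma tilde_mult_assoc: "(u \<odot> v) \<odot> w = u \<odot> (v \<odot> w)"
  by (simp add: tilde_mult_def scale_right_distrib scale_mult_left scale_mult_right
      distrib_left distrib_right mult.assoc add.assoc add.left_commute add.commute mult.commute)

lemma tilde_mult_add_left: "(u + v) \<odot> w = u \<odot> w + v \<odot> w"
  by (simp add: tilde_mult_def scale_right_distrib scale_left_distrib algebra_simps)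

lemma tilde_mult_add_right: "w \<odot> (u + v) = w \<odot> u + w \<odot> v"
  by (simp add: tilde_mult_def scale_right_distrib scale_left_distrib algebra_simps)

lemma tilde_mult_zero [simp]: "0 \<odot> w = 0" "w \<odot> 0 = 0"
  by (simp_all add: tilde_mult_def zero_prod_def)

lemma tilde_mult_sum_left: "(\<Sum>i\<in>A. f i) \<odot> w = (\<Sum>i\<in>A. f i \<odot> w)"
  by (induction A rule: infinite_finite_induct) (simp_all add: tilde_mult_add_left)

lemma tilde_mult_sum_right: "w \<odot> (\<Sum>i\<in>A. f i) = (\<Sum>i\<in>A. w \<odot> f i)"
  by (induction A rule: infinite_finite_induct) (simp_all add: tilde_mult_add_right)

lemma tilde_one_mult:
  assumes "u \<in> tilde"
  shows "tilde_one \<odot> u = u" and "u \<odot> tilde_one = u"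
proof -
  have "tilde_one \<odot> u = u \<and> u \<odot> tilde_one = u"
  proof (cases "\<exists>e::'b. is_identity e")
    case True
    then have "is_identity (THE e::'b. is_identity e)" using is_identity_the by blast
    then have "(THE e. is_identity e) * b = b \<and> b * (THE e. is_identity e) = b" for b :: 'b
      by (simp only: is_identity_def)
    then show ?thesis
      using assms True by (auto simp: tilde_def tilde_one_def tilde_mult_def)
  next
    case False
    then show ?thesis by (simp add: tilde_one_def tilde_mult_def)
  qed
  then show "tilde_one \<odot> u = u" and "u \<odot> tilde_one = u" by blast+
qed

section \<open>Multilinearity\<close>

text \<open>
  Linear dependence on one argument of a value in \<open>B\<close>, the latter embedded in the unitization as
  \<open>{0} \<times> B\<close>. Requiring the first component to vanish makes the condition stable under
  multiplication by an arbitrary element of the unitization on either side.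
\<close>

definition slot_linear :: "('b \<Rightarrow> 'k \<times> 'b) \<Rightarrow> bool" where
  "slot_linear F \<longleftrightarrow> (\<forall>x. fst (F x) = 0) \<and> Vector_Spaces.linear scale scale (\<lambda>x. snd (F x))"

lemma linear_iff_additive_homogeneous:
  "Vector_Spaces.linear scale scale f \<longleftrightarrow>
    (\<forall>x y. f (x + y) = f x + f y) \<and> (\<forall>c x. f (scale c x) = scale c (f x))"
  using Vector_Spaces.linear_iff[of scale scale f] vector_space_axioms by blast

lemma slot_linear_iff:
  "slot_linear F \<longleftrightarrow> (\<forall>x. fst (F x) = 0) \<and> (\<forall>x y. snd (F (x + y)) = snd (F x) + snd (F y)) \<and>
    (\<forall>c x. snd (F (scale c x)) = scale c (snd (F x)))"
  by (simp add: slot_linear_def linear_iff_additive_homogeneous)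

lemma slot_linear_zero: "slot_linear (\<lambda>x. 0)"
  by (simp add: slot_linear_iff)

lemma slot_linear_embed: "slot_linear (\<lambda>x. (0, x))"
  by (simp add: slot_linear_iff)

lemma slot_linear_add: "slot_linear F \<Longrightarrow> slot_linear G \<Longrightarrow> slot_linear (\<lambda>x. F x + G x)"
  by (simp add: slot_linear_iff scale_right_distrib)

lemma slot_linear_diff: "slot_linear F \<Longrightarrow> slot_linear G \<Longrightarrow> slot_linear (\<lambda>x. F x - G x)"
  by (simp add: slot_linear_iff scale_right_diff_distrib)

lemma slot_linear_sum:
  "(\<And>i. i \<in> A \<Longrightarrow> slot_linear (F i)) \<Longrightarrow> slot_linear (\<lambda>x. \<Sum>i\<in>A. F i x)"
  by (induction A rule: infinite_finite_induct) (auto intro: slot_linear_zero slot_linear_add)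

lemma slot_linear_mult_left: "slot_linear F \<Longrightarrow> slot_linear (\<lambda>x. F x \<odot> w)"
  by (simp add: slot_linear_iff tilde_mult_def scale_right_distrib scale_mult_left
      distrib_right scale_left_commute algebra_simps)

lemma slot_linear_mult_right: "slot_linear F \<Longrightarrow> slot_linear (\<lambda>x. w \<odot> F x)"
  by (simp add: slot_linear_iff tilde_mult_def scale_right_distrib scale_mult_right
      distrib_left scale_left_commute algebra_simps)

lemma slot_linear_compose:
  "slot_linear F \<Longrightarrow> slot_linear G \<Longrightarrow> slot_linear (\<lambda>x. F (snd (G x)))"
  by (simp add: slot_linear_iff)

lemma slot_linear_compose_linear:
  "Vector_Spaces.linear scale scale g \<Longrightarrow> slot_linear F \<Longrightarrow> slot_linear (\<lambda>x. (0, g (snd (F x))))"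
  by (simp add: slot_linear_iff linear_iff_additive_homogeneous)

lemma slot_linear_map_add: "slot_linear F \<Longrightarrow> F (x + y) = F x + F y"
  by (simp add: slot_linear_iff prod_eq_iff)

lemma slot_linear_map_zero: "slot_linear F \<Longrightarrow> F 0 = 0"
  using slot_linear_map_add[of F 0 0] by simp

lemma slot_linear_map_sum: "slot_linear F \<Longrightarrow> F (\<Sum>i\<in>A. f i) = (\<Sum>i\<in>A. F (f i))"
  by (induction A rule: infinite_finite_induct)
    (simp_all add: slot_linear_map_add slot_linear_map_zero)

lemma Mul_iff:
  "\<alpha> \<in> Mul scale \<longleftrightarrow>
    \<alpha> [] \<in> tilde \<and> (\<forall>bs i. i < length bs \<longrightarrow> slot_linear (\<lambda>x. \<alpha> (bs[i := x])))"
proof -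
  have "fst (\<alpha> bs) = 0"
    if "\<forall>bs i. i < length bs \<longrightarrow> (\<forall>x. fst (\<alpha> (bs[i := x])) = 0)" "bs \<noteq> []" for bs
    using that(1)[rule_format, of 0 bs "bs ! 0"] that(2) by simp
  moreover have "bs[i := x] \<noteq> []" if "i < length bs" for bs :: "'b list" and i x
    using that by auto
  ultimately show ?thesis unfolding Mul_def slot_linear_def by blast
qed

lemma slot_linear_Mul:
  assumes "\<alpha> \<in> Mul scale"
  shows "slot_linear (\<lambda>x. \<alpha> (us @ x # vs))"
proof -
  have "slot_linear (\<lambda>x. \<alpha> ((us @ 0 # vs)[length us := x]))"
    using assms unfolding Mul_iff by (simp del: list_update_length)
  then show ?thesis by simp
qed

lemma fst_Mul: "\<alpha> \<in> Mul scale \<Longrightarrow> bs \<noteq> [] \<Longrightarrow> fst (\<alpha> bs) = 0"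
  by (simp add: Mul_def)

lemma Mul_mem_tilde: "\<alpha> \<in> Mul scale \<Longrightarrow> \<alpha> bs \<in> tilde"
  by (cases "bs = []") (auto simp: Mul_def intro: embedded_mem_tilde)

text \<open>
  Expanding the entries from left to right. The prefix \<open>us\<close> stands for the entries that are already
  expanded; it is what the induction has to generalize over.
\<close>

lemma multiadditive_expansion:
  assumes "\<alpha> \<in> Mul scale" and fin: "\<And>x. finite (S x)"
  shows "\<alpha> (us @ map (\<lambda>x. \<Sum>y\<in>S x. g y) xs) = (\<Sum>ys\<in>listset (map S xs). \<alpha> (us @ map g ys))"
proof (induction xs arbitrary: us)
  case (Cons x xs)
  let ?L = "listset (map S xs)"
  have "\<alpha> (us @ map (\<lambda>x. \<Sum>y\<in>S x. g y) (x # xs)) =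
      (\<Sum>y\<in>S x. \<alpha> (us @ g y # map (\<lambda>x. \<Sum>y\<in>S x. g y) xs))"
    using slot_linear_map_sum[OF slot_linear_Mul[OF assms(1)]] by simp
  also have "\<dots> = (\<Sum>y\<in>S x. \<Sum>ys\<in>?L. \<alpha> (us @ map g (y # ys)))"
    using Cons.IH[of "us @ [g _]"] by simp
  also have "\<dots> = (\<Sum>(y, ys)\<in>S x \<times> ?L. \<alpha> (us @ map g (y # ys)))"
    by (rule sum.cartesian_product)
  also have "\<dots> = (\<Sum>ys\<in>listset (map S (x # xs)). \<alpha> (us @ map g ys))"
    by (rule sum.reindex_bij_witness[where i = "\<lambda>ys. (hd ys, tl ys)" and j = "\<lambda>(y, ys). y # ys"])
      (auto simp: set_Cons_def)
  finally show ?case .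
qed simp

section \<open>The ring laws for the formal product\<close>

lemma series_mult_assoc:
  "series_mult scale (series_mult scale \<alpha> \<beta>) \<gamma> = series_mult scale \<alpha> (series_mult scale \<beta> \<gamma>)"
proof
  fix bs
  have "series_mult scale (series_mult scale \<alpha> \<beta>) \<gamma> bs =
      (\<Sum>(p, w)\<in>cuts bs. \<Sum>(u, v)\<in>cuts p. \<alpha> u \<odot> (\<beta> v \<odot> \<gamma> w))"
    by (simp add: series_mult_eq_sum_cuts tilde_mult_sum_left tilde_mult_assoc case_prod_unfold)
  also have "\<dots> = (\<Sum>((p, w), (u, v))\<in>Sigma (cuts bs) (\<lambda>(p, w). cuts p). \<alpha> u \<odot> (\<beta> v \<odot> \<gamma> w))"
    by (simp add: sum.Sigma case_prod_unfold)
  also have "\<dots> = (\<Sum>((u, q), (v, w))\<in>Sigma (cuts bs) (\<lambda>(u, q). cuts q). \<alpha> u \<odot> (\<beta> v \<odot> \<gamma> w))"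
    by (rule sum.reindex_bij_witness[where i = "\<lambda>((u, q), (v, w)). ((u @ v, w), (u, v))"
          and j = "\<lambda>((p, w), (u, v)). ((u, v @ w), (v, w))"]) auto
  also have "\<dots> = (\<Sum>(u, q)\<in>cuts bs. \<Sum>(v, w)\<in>cuts q. \<alpha> u \<odot> (\<beta> v \<odot> \<gamma> w))"
    by (simp add: sum.Sigma case_prod_unfold)
  also have "\<dots> = series_mult scale \<alpha> (series_mult scale \<beta> \<gamma>) bs"
    by (simp add: series_mult_eq_sum_cuts tilde_mult_sum_right case_prod_unfold)
  finally show "series_mult scale (series_mult scale \<alpha> \<beta>) \<gamma> bs =
      series_mult scale \<alpha> (series_mult scale \<beta> \<gamma>) bs" .
qed

lemma series_mult_add_left:
  "series_mult scale (series_add \<alpha> \<beta>) \<gamma> =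
    series_add (series_mult scale \<alpha> \<gamma>) (series_mult scale \<beta> \<gamma>)"
  by (simp add: series_mult_def series_add_def tilde_mult_add_left sum.distrib)

lemma series_mult_add_right:
  "series_mult scale \<alpha> (series_add \<beta> \<gamma>) =
    series_add (series_mult scale \<alpha> \<beta>) (series_mult scale \<alpha> \<gamma>)"
  by (simp add: series_mult_def series_add_def tilde_mult_add_right sum.distrib)

lemma series_one_mem_Mul: "series_one \<in> Mul scale"
proof -
  have "(series_one (bs[i := x]) :: 'k \<times> 'b) = 0" if "i < length bs" for bs :: "'b list" and i x
    using that by (auto simp: series_one_def)
  then have "slot_linear (\<lambda>x. series_one (bs[i := x]))" if "i < length bs" for bs i
    using that by (simp add: slot_linear_zero)
  moreover have "(series_one [] :: 'k \<times> 'b) \<in> tilde" by (simp add: series_one_def tilde_one_mem_tilde)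
  ultimately show ?thesis by (simp add: Mul_iff)
qed

lemma series_one_mult:
  assumes "\<alpha> \<in> Mul scale"
  shows "series_mult scale series_one \<alpha> = \<alpha>" and "series_mult scale \<alpha> series_one = \<alpha>"
proof -
  show "series_mult scale series_one \<alpha> = \<alpha>"
  proof
    fix bs
    have "series_mult scale series_one \<alpha> bs =
        (\<Sum>k=0..length bs. if k = 0 then tilde_one \<odot> \<alpha> bs else 0)"
      unfolding series_mult_def by (rule sum.cong) (auto simp: series_one_def)
    then show "series_mult scale series_one \<alpha> bs = \<alpha> bs"
      using tilde_one_mult(1) Mul_mem_tilde[OF assms] by simp
  qed
  show "series_mult scale \<alpha> series_one = \<alpha>"
  proof
    fix bs
    have "series_mult scale \<alpha> series_one bs =
        (\<Sum>k=0..length bs. if k = length bs then \<alpha> bs \<odot> tilde_one else 0)"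
      unfolding series_mult_def by (rule sum.cong) (auto simp: series_one_def)
    then show "series_mult scale \<alpha> series_one bs = \<alpha> bs"
      using tilde_one_mult(2) Mul_mem_tilde[OF assms] by simp
  qed
qed

section \<open>Multiplicative inverses\<close>

text \<open>
  The solution \<open>\<delta>\<close> of \<open>\<alpha>\<delta> = 1\<close>, where \<open>u\<close> is a right inverse of \<open>\<alpha>\<^sub>0\<close>. The term \<open>k = 0\<close> of the
  product is \<open>\<alpha>\<^sub>0 \<delta>(bs)\<close>; the others are moved to the right-hand side.
\<close>

function mult_right_inverse ::
    "('k \<times> 'b) \<Rightarrow> ('k, 'b) series \<Rightarrow> ('k, 'b) series" where
  "mult_right_inverse u \<alpha> bs = u \<odot>
     (series_one bs - (\<Sum>k=1..length bs. \<alpha> (take k bs) \<odot> mult_right_inverse u \<alpha> (drop k bs)))"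
  by auto
termination by (relation "measure (\<lambda>(u, \<alpha>, bs). length bs)") auto

declare mult_right_inverse.simps [simp del]

lemma mult_right_inverse_Nil: "u \<in> tilde \<Longrightarrow> mult_right_inverse u \<alpha> [] = u"
  by (subst mult_right_inverse.simps) (simp add: series_one_def tilde_one_mult)

text \<open>
  Changing the \<open>i\<close>th argument affects only one factor of each term: the left one if \<open>i < k\<close>, which
  is linear because \<open>\<alpha>\<close> is, and otherwise the right one, which is linear by induction since
  \<open>k \<ge> 1\<close>.
\<close>

lemma mult_right_inverse_mem_Mul:
  assumes \<alpha>: "\<alpha> \<in> Mul scale" and u: "u \<in> tilde"
  shows "mult_right_inverse u \<alpha> \<in> Mul scale"
proof -
  let ?\<delta> = "mult_right_inverse u \<alpha>"
  have "slot_linear (\<lambda>x. ?\<delta> (bs[i := x]))" if "i < length bs" for bs i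
    using that
  proof (induction "length bs" arbitrary: bs i rule: less_induct)
    case less
    have one: "series_one (bs[i := x]) = 0" for x
      using less.prems by (auto simp: series_one_def)
    have "slot_linear (\<lambda>x. \<alpha> (take k (bs[i := x])) \<odot> ?\<delta> (drop k (bs[i := x])))"
      if k: "k \<in> {1..length bs}" for k
    proof (cases "i < k")
      case True
      then have "slot_linear (\<lambda>x. \<alpha> ((take k bs)[i := x]))"
        using \<alpha> less.prems by (simp add: Mul_iff)
      then show ?thesis
        using True by (simp add: take_update_swap slot_linear_mult_left)
    next
      case False
      then have "slot_linear (\<lambda>x. ?\<delta> ((drop k bs)[i - k := x]))"
        using k less.prems by (intro less.hyps) auto
      then show ?thesis
        using False by (simp add: drop_update_swap slot_linear_mult_right)
    qed
    then have "slot_linear (\<lambda>x. u \<odot> (0 -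
        (\<Sum>k=1..length bs. \<alpha> (take k (bs[i := x])) \<odot> ?\<delta> (drop k (bs[i := x])))))"
      by (intro slot_linear_mult_right slot_linear_diff slot_linear_zero slot_linear_sum)
    then show ?case by (subst mult_right_inverse.simps) (simp add: one)
  qed
  then show ?thesis using mult_right_inverse_Nil u by (simp add: Mul_iff)
qed

lemma series_mult_right_inverse:
  assumes \<alpha>: "\<alpha> \<in> Mul scale" and u: "u \<in> tilde" and inv: "\<alpha> [] \<odot> u = tilde_one"
  shows "series_mult scale \<alpha> (mult_right_inverse u \<alpha>) = series_one"
proof
  fix bs
  let ?\<delta> = "mult_right_inverse u \<alpha>"
  let ?s = "\<Sum>k=1..length bs. \<alpha> (take k bs) \<odot> ?\<delta> (drop k bs)"
  have "fst (\<alpha> (take k bs)) = 0" if "k \<in> {1..length bs}" for k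
    using that by (intro fst_Mul[OF \<alpha>]) auto
  then have "fst ?s = 0"
    by (simp add: fst_sum)
  \<comment> \<open>In the unital case \<open>tilde_one\<close> acts as an identity on \<open>tilde\<close> only, not on all of \<open>K \<times> B\<close>.\<close>
  then have z: "series_one bs - ?s \<in> tilde"
    by (intro diff_mem_tilde embedded_mem_tilde[of ?s] Mul_mem_tilde series_one_mem_Mul)
  have "series_mult scale \<alpha> ?\<delta> bs = \<alpha> [] \<odot> ?\<delta> bs + ?s"
    unfolding series_mult_def by (simp add: sum.atLeast_Suc_atMost)
  also have "\<alpha> [] \<odot> ?\<delta> bs = (\<alpha> [] \<odot> u) \<odot> (series_one bs - ?s)"
    by (subst mult_right_inverse.simps) (simp add: tilde_mult_assoc)
  also have "\<dots> = series_one bs - ?s"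
    using inv tilde_one_mult(1)[OF z] by simp
  finally show "series_mult scale \<alpha> ?\<delta> bs = series_one bs" by simp
qed

lemma mult_invertible_iff:
  assumes \<alpha>: "\<alpha> \<in> Mul scale"
  shows "(\<exists>\<delta>\<in>Mul scale. series_mult scale \<alpha> \<delta> = series_one \<and> series_mult scale \<delta> \<alpha> = series_one)
    \<longleftrightarrow> (\<exists>u\<in>tilde. \<alpha> [] \<odot> u = tilde_one \<and> u \<odot> \<alpha> [] = tilde_one)"
proof
  assume "\<exists>\<delta>\<in>Mul scale. series_mult scale \<alpha> \<delta> = series_one \<and> series_mult scale \<delta> \<alpha> = series_one"
  then obtain \<delta> where "\<delta> \<in> Mul scale"
    and "series_mult scale \<alpha> \<delta> [] = series_one []" "series_mult scale \<delta> \<alpha> [] = series_one []"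
    by auto
  then show "\<exists>u\<in>tilde. \<alpha> [] \<odot> u = tilde_one \<and> u \<odot> \<alpha> [] = tilde_one"
    using Mul_mem_tilde[of \<delta> "[]"] by (auto simp: series_mult_Nil series_one_def)
next
  assume "\<exists>u\<in>tilde. \<alpha> [] \<odot> u = tilde_one \<and> u \<odot> \<alpha> [] = tilde_one"
  then obtain u where u: "u \<in> tilde" "\<alpha> [] \<odot> u = tilde_one" "u \<odot> \<alpha> [] = tilde_one" by blast
  \<comment> \<open>\<open>\<delta>\<close> is a right inverse of \<open>\<alpha>\<close>, and \<open>\<epsilon>\<close> one of \<open>\<delta>\<close>, whose term \<open>\<delta>\<^sub>0 = u\<close> has the right
    inverse \<open>\<alpha>\<^sub>0\<close>.\<close>
  define \<delta> where "\<delta> = mult_right_inverse u \<alpha>"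
  define \<epsilon> where "\<epsilon> = mult_right_inverse (\<alpha> []) \<delta>"
  have \<delta>: "\<delta> \<in> Mul scale" "series_mult scale \<alpha> \<delta> = series_one" "\<delta> [] = u"
    using mult_right_inverse_mem_Mul series_mult_right_inverse mult_right_inverse_Nil \<alpha> u
    by (auto simp: \<delta>_def)
  have \<epsilon>: "\<epsilon> \<in> Mul scale" "series_mult scale \<delta> \<epsilon> = series_one"
    using mult_right_inverse_mem_Mul series_mult_right_inverse \<delta> u(3) Mul_mem_tilde[OF \<alpha>]
    by (auto simp: \<epsilon>_def)
  have "\<alpha> = series_mult scale \<alpha> (series_mult scale \<delta> \<epsilon>)"
    by (simp add: \<epsilon> series_one_mult \<alpha>)
  also have "\<dots> = series_mult scale (series_mult scale \<alpha> \<delta>) \<epsilon>"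
    by (rule series_mult_assoc[symmetric])
  also have "\<dots> = \<epsilon>"
    by (simp only: \<delta>(2) series_one_mult(1)[OF \<epsilon>(1)])
  finally show "\<exists>\<delta>\<in>Mul scale. series_mult scale \<alpha> \<delta> = series_one \<and> series_mult scale \<delta> \<alpha> = series_one"
    using \<delta> \<epsilon> by metis
qed

section \<open>The laws for formal composition\<close>

text \<open>
  The left-hand side is indexed by pairs \<open>(B, C)\<close> with \<open>C\<close> a grouping of the blocks of \<open>B\<close>, the
  right-hand side by pairs \<open>(D, C)\<close> with \<open>C\<close> a refinement of the blocks of \<open>D\<close>. In both cases \<open>C\<close>
  determines the pair, and the same lists \<open>C\<close> occur.
\<close>

lemma series_comp_assoc:
  assumes "\<alpha> \<in> Mul scale"
  shows "series_comp (series_comp \<alpha> \<beta>) \<gamma> = series_comp \<alpha> (series_comp \<beta> \<gamma>)"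
proof
  fix bs
  let ?c = "\<lambda>xs. snd (\<gamma> xs)"
  let ?b = "\<lambda>xss. snd (\<beta> (map ?c xss))"
  have "series_comp (series_comp \<alpha> \<beta>) \<gamma> bs =
      (\<Sum>B\<in>splittings bs. \<Sum>C\<in>splittings B. \<alpha> (map ?b C))"
    by (simp add: series_comp_eq_sum_splittings sum_splittings_map comp_def)
  also have "\<dots> = (\<Sum>(B, C)\<in>Sigma (splittings bs) splittings. \<alpha> (map ?b C))"
    by (simp add: sum.Sigma)
  also have "\<dots> = (\<Sum>(D, C)\<in>Sigma (splittings bs) (\<lambda>D. listset (map splittings D)). \<alpha> (map ?b C))"
  proof (rule sum.reindex_bij_witness[where i = "\<lambda>(D, C). (concat C, C)"
        and j = "\<lambda>(B, C). (map concat C, C)"])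
    fix p assume "p \<in> Sigma (splittings bs) splittings"
    then obtain C where C: "p = (concat C, C)" "concat (concat C) = bs"
      "[] \<notin> set (concat C)" "[] \<notin> set C"
      by (auto simp: splittings_def)
    have "concat E \<noteq> []" if "E \<in> set C" for E
    proof -
      have "E \<noteq> []" "\<forall>e\<in>set E. e \<noteq> []" using that C(3,4) by auto
      then show ?thesis by (cases E) auto
    qed
    then have "[] \<notin> set (map concat C)" unfolding set_map by (metis imageE)
    then have "map concat C \<in> splittings bs"
      by (simp only: splittings_def mem_Collect_eq concat_map_concat C(2) simp_thms)
    moreover have "C \<in> listset (map splittings (map concat C))"
      using C(3) by (auto simp only: mem_listset_splittings set_concat)
    ultimately show "(case p of (B, C) \<Rightarrow> (map concat C, C)) \<in>
        Sigma (splittings bs) (\<lambda>D. listset (map splittings D))"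
      by (simp only: C(1) prod.case mem_Sigma_iff simp_thms)
  next
    fix p assume "p \<in> Sigma (splittings bs) (\<lambda>D. listset (map splittings D))"
    then obtain C where C: "p = (map concat C, C)" "concat (map concat C) = bs"
      "[] \<notin> set (map concat C)" "\<forall>E\<in>set C. [] \<notin> set E"
      by (auto simp: splittings_def mem_listset_splittings)
    have "[] \<notin> set C" using C(3) by force
    moreover have "concat (concat C) = bs" using C(2) by (simp add: concat_map_concat)
    ultimately show "(case p of (D, C) \<Rightarrow> (concat C, C)) \<in> Sigma (splittings bs) splittings"
      using C(4) by (auto simp: C(1) splittings_def)
  qed (auto simp: splittings_def mem_listset_splittings)
  also have "\<dots> = (\<Sum>D\<in>splittings bs. \<Sum>C\<in>listset (map splittings D). \<alpha> (map ?b C))"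
    by (simp add: sum.Sigma finite_listset_map)
  also have "\<dots> = (\<Sum>D\<in>splittings bs. \<alpha> (map (\<lambda>d. \<Sum>E\<in>splittings d. ?b E) D))"
    using multiadditive_expansion[OF assms, of splittings "[]" ?b] by simp
  also have "\<dots> = series_comp \<alpha> (series_comp \<beta> \<gamma>) bs"
    by (simp add: series_comp_eq_sum_splittings snd_sum)
  finally show "series_comp (series_comp \<alpha> \<beta>) \<gamma> bs = series_comp \<alpha> (series_comp \<beta> \<gamma>) bs" .
qed

lemma series_comp_add:
  "series_comp (series_add \<alpha> \<beta>) \<gamma> = series_add (series_comp \<alpha> \<gamma>) (series_comp \<beta> \<gamma>)"
  by (rule ext) (simp add: series_comp_eq_sum_splittings series_add_def sum.distrib)

text \<open>
  A pair \<open>(X, Y)\<close> of lists of blocks is both a cut of the splitting \<open>X @ Y\<close> of \<open>bs\<close>, and a pair of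
  splittings of the two parts in the cut \<open>(concat X, concat Y)\<close> of \<open>bs\<close>.
\<close>

lemma series_comp_mult:
  "series_comp (series_mult scale \<alpha> \<beta>) \<gamma> =
    series_mult scale (series_comp \<alpha> \<gamma>) (series_comp \<beta> \<gamma>)"
proof
  fix bs
  let ?c = "\<lambda>xs. snd (\<gamma> xs)"
  let ?t = "\<lambda>X Y. \<alpha> (map ?c X) \<odot> \<beta> (map ?c Y)"
  have "series_mult scale \<alpha> \<beta> (map ?c B) = (\<Sum>(X, Y)\<in>cuts B. ?t X Y)" for B
    unfolding series_mult_def
    by (simp add: take_map drop_map sum.reindex_bij_betw[OF bij_betw_cuts, symmetric])
  then have "series_comp (series_mult scale \<alpha> \<beta>) \<gamma> bs =
      (\<Sum>B\<in>splittings bs. \<Sum>(X, Y)\<in>cuts B. ?t X Y)"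
    by (simp add: series_comp_eq_sum_splittings)
  also have "\<dots> = (\<Sum>(B, (X, Y))\<in>Sigma (splittings bs) cuts. ?t X Y)"
    by (simp add: sum.Sigma case_prod_unfold)
  also have "\<dots> = (\<Sum>((us, vs), (X, Y))\<in>Sigma (cuts bs) (\<lambda>(us, vs). splittings us \<times> splittings vs).
      ?t X Y)"
    by (rule sum.reindex_bij_witness[where i = "\<lambda>((us, vs), (X, Y)). (X @ Y, (X, Y))"
          and j = "\<lambda>(B, (X, Y)). ((concat X, concat Y), (X, Y))"])
      (auto simp: splittings_def)
  also have "\<dots> = (\<Sum>(us, vs)\<in>cuts bs. \<Sum>(X, Y)\<in>splittings us \<times> splittings vs. ?t X Y)"
    by (simp add: sum.Sigma case_prod_unfold)
  also have "\<dots> = (\<Sum>(us, vs)\<in>cuts bs. \<Sum>X\<in>splittings us. \<Sum>Y\<in>splittings vs. ?t X Y)"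
    by (simp add: sum.cartesian_product)
  also have "\<dots> = series_mult scale (series_comp \<alpha> \<gamma>) (series_comp \<beta> \<gamma>) bs"
    by (simp only: series_mult_eq_sum_cuts series_comp_eq_sum_splittings tilde_mult_sum_left)
      (simp only: tilde_mult_sum_right)
  finally show "series_comp (series_mult scale \<alpha> \<beta>) \<gamma> bs =
      series_mult scale (series_comp \<alpha> \<gamma>) (series_comp \<beta> \<gamma>) bs" .
qed

lemma slot_linear_series_id: "i < length bs \<Longrightarrow> slot_linear (\<lambda>x. series_id (bs[i := x]))"
  by (cases "length bs = 1")
    (auto simp: length_Suc_conv slot_linear_embed slot_linear_zero series_id_eq_zero)

lemma series_id_mem_Mul: "series_id \<in> Mul scale"
  by (simp add: Mul_iff slot_linear_series_id zero_mem_tilde)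

text \<open>
  Unless all blocks are singletons, some block is sent to \<open>0\<close> by the identity series, and a
  multilinear map vanishes if one of its arguments does.
\<close>

lemma series_comp_id_right:
  assumes "\<alpha> \<in> Mul scale"
  shows "series_comp \<alpha> series_id = \<alpha>"
proof
  fix bs :: "'b list"
  let ?i = "\<lambda>xs :: 'b list. snd (series_id xs :: 'k \<times> 'b)"
  let ?C = "map (\<lambda>b. [b]) bs"
  have zero: "\<alpha> (map ?i B) = 0" if "B \<in> splittings bs - {?C}" for B
  proof -
    have "\<exists>xs\<in>set B. length xs \<noteq> 1"
    proof (rule ccontr)
      assume "\<not> (\<exists>xs\<in>set B. length xs \<noteq> 1)"
      then have "B = map (\<lambda>b. [b]) (concat B)"
        by (induction B) (auto simp: length_Suc_conv)
      then show False using that by (auto simp: splittings_def)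
    qed
    then obtain us xs vs where B: "B = us @ xs # vs" and "length xs \<noteq> 1"
      by (meson split_list)
    then have "?i xs = 0" by (simp add: series_id_eq_zero)
    then show ?thesis
      using slot_linear_map_zero[OF slot_linear_Mul[OF assms]] by (simp add: B)
  qed
  have mem: "?C \<in> splittings bs" by (auto simp: splittings_def)
  have "series_comp \<alpha> series_id bs = \<alpha> (map ?i ?C) + (\<Sum>B\<in>splittings bs - {?C}. \<alpha> (map ?i B))"
    unfolding series_comp_eq_sum_splittings by (rule sum.remove[OF finite_splittings mem])
  also have "(\<Sum>B\<in>splittings bs - {?C}. \<alpha> (map ?i B)) = 0"
    using zero by (intro sum.neutral) blast
  finally show "series_comp \<alpha> series_id bs = \<alpha> bs" by (simp add: comp_def)
qed

text \<open>
  The only splitting of a nonempty \<open>bs\<close> into fewer than two blocks is \<open>[bs]\<close>. It contributes \<open>\<alpha>\<^sub>1(\<beta>(bs))\<close>, the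
  only term that involves \<open>\<beta>\<close> on the whole list.
\<close>

lemma series_comp_eq_linear_part_plus:
  assumes "bs \<noteq> []"
  shows "series_comp \<alpha> \<beta> bs = \<alpha> [snd (\<beta> bs)] +
    (\<Sum>xss | xss \<in> splittings bs \<and> 2 \<le> length xss. \<alpha> (map (\<lambda>xs. snd (\<beta> xs)) xss))"
proof -
  have "xss \<noteq> [bs] \<longleftrightarrow> 2 \<le> length xss" if "xss \<in> splittings bs" for xss
    using splittings_length_less_2[OF that assms] by (cases "length xss < 2") auto
  then have "splittings bs - {[bs]} = {xss. xss \<in> splittings bs \<and> 2 \<le> length xss}"
    by auto
  then show ?thesis
    unfolding series_comp_eq_sum_splittings
    by (subst sum.remove[OF finite_splittings singleton_mem_splittings[OF assms]]) simp
qed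

lemma series_comp_id_left:
  assumes \<alpha>: "\<alpha> \<in> Mul scale" and "\<alpha> [] = 0"
  shows "series_comp series_id \<alpha> = \<alpha>"
proof
  fix bs
  show "series_comp series_id \<alpha> bs = \<alpha> bs"
  proof (cases "bs = []")
    case True
    then show ?thesis using assms(2) by (simp add: series_comp_Nil)
  next
    case False
    have "series_comp series_id \<alpha> bs = (0, snd (\<alpha> bs))"
      by (auto simp: series_comp_eq_linear_part_plus[OF False] series_id_eq_zero
          intro!: sum.neutral)
    also have "\<dots> = \<alpha> bs" using fst_Mul[OF \<alpha> False] by (simp add: prod_eq_iff)
    finally show ?thesis .
  qed
qed

section \<open>Compositional inverses\<close>

text \<open>
  The solution \<open>\<delta>\<close> of \<open>\<alpha> \<circ> \<delta> = I\<close>, where \<open>g\<close> is a right inverse of \<open>\<alpha>\<^sub>1\<close>. The splitting of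
  \<open>bs\<close> into one block contributes \<open>\<alpha>\<^sub>1(\<delta>(bs))\<close>; the others are moved to the right-hand side. For
  \<open>bs = []\<close> the formula gives \<open>g 0\<close>, as the empty splitting has fewer than two blocks.
\<close>

function comp_right_inverse ::
    "('b \<Rightarrow> 'b) \<Rightarrow> ('k, 'b) series \<Rightarrow> ('k, 'b) series" where
  "comp_right_inverse g \<alpha> bs = (0, g (snd (series_id bs -
     (\<Sum>xss | xss \<in> splittings bs \<and> 2 \<le> length xss.
        \<alpha> (map (\<lambda>xs. snd (comp_right_inverse g \<alpha> xs)) xss)))))"
  by auto
termination by (relation "measure (\<lambda>(g, \<alpha>, bs). length bs)") (auto intro: block_shorter)

declare comp_right_inverse.simps [simp del]

text \<open>
  Linearity of a single term of a composition. Here \<open>C\<close> splits the list of positions rather than the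
  list \<open>bs\<close> itself, so that it stays fixed while an entry of \<open>bs\<close> varies. Exactly one block contains
  the position \<open>i\<close>; the value of \<open>\<phi>\<close> there is linear in \<open>x\<close>, and \<open>\<alpha>\<close> is linear in that value.
\<close>

lemma slot_linear_of_blocks:
  assumes \<alpha>: "\<alpha> \<in> Mul scale" and C: "C \<in> splittings [0..<length bs]" and i: "i < length bs"
    and \<phi>: "\<And>J l. J \<in> set C \<Longrightarrow> l < length J \<Longrightarrow> slot_linear (\<lambda>x. \<phi> ((map ((!) bs) J)[l := x]))"
  shows "slot_linear (\<lambda>x. \<alpha> (map (\<lambda>J. snd (\<phi> (map ((!) (bs[i := x])) J))) C))"
proof -
  let ?f = "\<lambda>J. snd (\<phi> (map ((!) bs) J))"
  have c: "concat C = [0..<length bs]" using C by (simp add: splittings_def)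
  then have "i \<in> set (concat C)" using i by simp
  then obtain J where "J \<in> set C" "i \<in> set J" by auto
  then obtain C1 C2 J1 J2 where e: "C = C1 @ J # C2" and J: "J = J1 @ i # J2"
    by (meson split_list)
  have d: "distinct (concat (C1 @ (J1 @ i # J2) # C2))" using c by (simp flip: e J)
  have same: "map ((!) (bs[i := x])) L = map ((!) bs) L" if "i \<notin> set L" for L x
    using that by (auto intro!: map_cong nth_list_update_neq)
  have "map ((!) (bs[i := x])) J = (map ((!) bs) J)[length J1 := x]" for x
    using d i by (simp add: J same list_update_append)
  moreover have "map (\<lambda>J. snd (\<phi> (map ((!) (bs[i := x])) J))) C1 = map ?f C1"
    "map (\<lambda>J. snd (\<phi> (map ((!) (bs[i := x])) J))) C2 = map ?f C2" for x
    using d by (auto intro!: arg_cong[where f = "\<lambda>y. snd (\<phi> y)"] same)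
  moreover have "slot_linear (\<lambda>x. \<alpha> (map ?f C1 @ snd (\<phi> ((map ((!) bs) J)[length J1 := x])) # map ?f C2))"
    by (rule slot_linear_compose[OF slot_linear_Mul[OF \<alpha>]], rule \<phi>) (simp_all add: e J)
  ultimately show ?thesis unfolding e by (simp only: map_append list.map)
qed

lemma comp_right_inverse_mem_Mul:
  assumes \<alpha>: "\<alpha> \<in> Mul scale" and g: "Vector_Spaces.linear scale scale g"
  shows "comp_right_inverse g \<alpha> \<in> Mul scale"
proof -
  let ?\<delta> = "comp_right_inverse g \<alpha>"
  have "slot_linear (\<lambda>x. ?\<delta> (bs[i := x]))" if "i < length bs" for bs i
    using that
  proof (induction "length bs" arbitrary: bs i rule: less_induct)
    case less
    let ?I = "{C \<in> splittings [0..<length bs]. 2 \<le> length C}"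
    let ?t = "\<lambda>x C. \<alpha> (map (\<lambda>J. snd (?\<delta> (map ((!) (bs[i := x])) J))) C)"
    have "slot_linear (\<lambda>x. ?t x C)" if C: "C \<in> ?I" for C
    proof (rule slot_linear_of_blocks[OF \<alpha> _ less.prems])
      fix J l assume "J \<in> set C" "l < length J"
      moreover from this have "length J < length bs"
        using block_shorter[of C "[0..<length bs]"] C by simp
      ultimately show "slot_linear (\<lambda>x. ?\<delta> ((map ((!) bs) J)[l := x]))"
        by (intro less.hyps) simp_all
    qed (use C in simp)
    then have "slot_linear (\<lambda>x. (0, g (snd (series_id (bs[i := x]) - (\<Sum>C\<in>?I. ?t x C)))))"
      by (intro slot_linear_compose_linear g slot_linear_diff slot_linear_sum
          slot_linear_series_id less.prems)
    moreover have "?\<delta> (bs[i := x]) = (0, g (snd (series_id (bs[i := x]) - (\<Sum>C\<in>?I. ?t x C))))" for x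
      using sum_long_splittings_map[where xs = "[0..<length bs]" and f = "(!) (bs[i := x])" and k = 2
          and h = "\<lambda>xss. \<alpha> (map (\<lambda>xs. snd (?\<delta> xs)) xss)"]
        map_nth[of "bs[i := x]"]
      by (subst comp_right_inverse.simps) (simp add: comp_def)
    ultimately show ?case by simp
  qed
  moreover have "?\<delta> [] \<in> tilde"
    by (rule embedded_mem_tilde, subst comp_right_inverse.simps) simp
  ultimately show ?thesis by (simp add: Mul_iff)
qed

lemma comp_right_inverse_Nil:
  assumes "Vector_Spaces.linear scale scale g"
  shows "comp_right_inverse g \<alpha> [] = 0"
proof -
  have "g 0 = 0"
    using assms by (metis add_cancel_right_right linear_iff_additive_homogeneous)
  moreover have none: "{xss. xss \<in> splittings ([] :: 'b list) \<and> 2 \<le> length xss} = {}" by auto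
  ultimately show ?thesis
    by (subst comp_right_inverse.simps, simp only: none) (simp add: zero_prod_def)
qed

lemma comp_right_inverse_single: "comp_right_inverse g \<alpha> [b] = (0, g b)"
proof -
  have none: "{xss. xss \<in> splittings [b] \<and> 2 \<le> length xss} = {}"
    by (auto simp: splittings_single)
  show ?thesis by (subst comp_right_inverse.simps, simp only: none) simp
qed

lemma series_comp_right_inverse:
  assumes \<alpha>: "\<alpha> \<in> Mul scale" "\<alpha> [] = 0" and inv: "\<And>b. snd (\<alpha> [g b]) = b"
  shows "series_comp \<alpha> (comp_right_inverse g \<alpha>) = series_id"
proof
  fix bs
  let ?\<delta> = "comp_right_inverse g \<alpha>"
  show "series_comp \<alpha> ?\<delta> bs = series_id bs"
  proof (cases "bs = []")
    case True
    then show ?thesis using \<alpha>(2) by (simp add: series_comp_Nil)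
  next
    case False
    let ?s = "\<Sum>xss | xss \<in> splittings bs \<and> 2 \<le> length xss. \<alpha> (map (\<lambda>xs. snd (?\<delta> xs)) xss)"
    have "fst (\<alpha> (map f xss)) = 0" if "2 \<le> length xss" for f and xss :: "'b list list"
      using that by (intro fst_Mul[OF \<alpha>(1)]) auto
    then have "fst ?s = 0" by (simp add: fst_sum)
    moreover have "snd (?\<delta> bs) = g (snd (series_id bs - ?s))"
      by (subst comp_right_inverse.simps) simp
    then have "\<alpha> [snd (?\<delta> bs)] = (0, snd (series_id bs - ?s))"
      by (intro prod_eqI) (simp_all only: inv fst_Mul[OF \<alpha>(1)] fst_conv snd_conv list.distinct not_False_eq_True)
    moreover have "fst (series_id bs :: 'k \<times> 'b) = 0"
      using fst_Mul[OF series_id_mem_Mul False] .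
    ultimately show ?thesis
      by (simp add: series_comp_eq_linear_part_plus[OF False] prod_eq_iff)
  qed
qed

lemma comp_invertible_iff:
  assumes \<alpha>: "\<alpha> \<in> Mul scale" "\<alpha> [] = 0"
  shows "(\<exists>\<delta>\<in>Mul scale. \<delta> [] = 0 \<and> series_comp \<alpha> \<delta> = series_id \<and> series_comp \<delta> \<alpha> = series_id)
    \<longleftrightarrow> (\<exists>g\<in>linear_maps scale. (\<lambda>b. snd (\<alpha> [b])) \<circ> g = id \<and> g \<circ> (\<lambda>b. snd (\<alpha> [b])) = id)"
proof
  assume "\<exists>\<delta>\<in>Mul scale. \<delta> [] = 0 \<and> series_comp \<alpha> \<delta> = series_id \<and> series_comp \<delta> \<alpha> = series_id"
  then obtain \<delta> where \<delta>: "\<delta> \<in> Mul scale"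
    and eq: "series_comp \<alpha> \<delta> = series_id" "series_comp \<delta> \<alpha> = series_id" by blast
  have "(\<lambda>b. snd (\<delta> [b])) \<in> linear_maps scale"
    using slot_linear_Mul[OF \<delta>, of "[]" "[]"] by (simp add: linear_maps_def slot_linear_def)
  moreover have "snd (\<alpha> [snd (\<delta> [b])]) = b" "snd (\<delta> [snd (\<alpha> [b])]) = b" for b
    using eq[THEN fun_cong, of "[b]"] by (simp_all add: series_comp_single)
  ultimately show "\<exists>g\<in>linear_maps scale. (\<lambda>b. snd (\<alpha> [b])) \<circ> g = id \<and> g \<circ> (\<lambda>b. snd (\<alpha> [b])) = id"
    by (intro bexI[of _ "\<lambda>b. snd (\<delta> [b])"]) (auto simp: fun_eq_iff)
next
  let ?a = "\<lambda>b. snd (\<alpha> [b])"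
  assume "\<exists>g\<in>linear_maps scale. ?a \<circ> g = id \<and> g \<circ> ?a = id"
  then obtain g where g: "Vector_Spaces.linear scale scale g"
    and ag: "?a (g b) = b" and ga: "g (?a b) = b" for b
    by (auto simp: linear_maps_def fun_eq_iff)
  have a: "Vector_Spaces.linear scale scale ?a"
    using slot_linear_Mul[OF \<alpha>(1), of "[]" "[]"] by (simp add: slot_linear_def)
  \<comment> \<open>The linear term of \<open>\<delta>\<close> is \<open>g\<close>, with right inverse \<open>\<alpha>\<^sub>1\<close>, so that \<open>\<epsilon>\<close> is a right inverse of \<open>\<delta>\<close>.\<close>
  define \<delta> where "\<delta> = comp_right_inverse g \<alpha>"
  define \<epsilon> where "\<epsilon> = comp_right_inverse ?a \<delta>"
  have \<delta>: "\<delta> \<in> Mul scale" "\<delta> [] = 0" "series_comp \<alpha> \<delta> = series_id"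
    unfolding \<delta>_def
    by (rule comp_right_inverse_mem_Mul[OF \<alpha>(1) g] comp_right_inverse_Nil[OF g]
        series_comp_right_inverse[OF \<alpha> ag])+
  have \<delta>a: "snd (\<delta> [?a b]) = b" for b
    by (simp add: \<delta>_def comp_right_inverse_single ga)
  have \<epsilon>: "\<epsilon> \<in> Mul scale" "\<epsilon> [] = 0" "series_comp \<delta> \<epsilon> = series_id"
    unfolding \<epsilon>_def
    by (rule comp_right_inverse_mem_Mul[OF \<delta>(1) a] comp_right_inverse_Nil[OF a]
        series_comp_right_inverse[OF \<delta>(1,2) \<delta>a])+
  have "\<alpha> = series_comp \<alpha> (series_comp \<delta> \<epsilon>)"
    by (simp add: \<epsilon> series_comp_id_right \<alpha>)
  also have "\<dots> = series_comp (series_comp \<alpha> \<delta>) \<epsilon>"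
    by (rule series_comp_assoc[OF \<alpha>(1), symmetric])
  also have "\<dots> = \<epsilon>"
    by (simp only: \<delta>(3) series_comp_id_left[OF \<epsilon>(1,2)])
  finally show "\<exists>\<delta>\<in>Mul scale. \<delta> [] = 0 \<and> series_comp \<alpha> \<delta> = series_id \<and> series_comp \<delta> \<alpha> = series_id"
    using \<delta> \<epsilon> by metis
qed

end

section \<open>The algebra of multilinear series\<close>

theorem proposition2p3:
  fixes scale :: "'k::field \<Rightarrow> 'b::ring \<Rightarrow> 'b"
    and \<alpha> \<beta> \<gamma> :: "('k, 'b) series"
  assumes "algebra_over_field scale"
    and "\<alpha> \<in> Mul scale" and "\<beta> \<in> Mul scale" and "\<gamma> \<in> Mul scale"
  shows
    "(series_mult scale (series_mult scale \<alpha> \<beta>) \<gamma> = series_mult scale \<alpha> (series_mult scale \<beta> \<gamma>)) \<and>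
     (series_mult scale (series_add \<alpha> \<beta>) \<gamma>
        = series_add (series_mult scale \<alpha> \<gamma>) (series_mult scale \<beta> \<gamma>) \<and>
      series_mult scale \<alpha> (series_add \<beta> \<gamma>)
        = series_add (series_mult scale \<alpha> \<beta>) (series_mult scale \<alpha> \<gamma>)) \<and>
     (series_one \<in> Mul scale \<and>
      series_mult scale series_one \<alpha> = \<alpha> \<and> series_mult scale \<alpha> series_one = \<alpha>) \<and>
     ((\<exists>\<delta>\<in>Mul scale. series_mult scale \<alpha> \<delta> = series_one \<and> series_mult scale \<delta> \<alpha> = series_one)
        \<longleftrightarrow> (\<exists>u\<in>tilde. tilde_mult scale (\<alpha> []) u = tilde_one \<and>
                       tilde_mult scale u (\<alpha> []) = tilde_one)) \<and>
     (\<beta> [] = 0 \<and> \<gamma> [] = 0 \<longrightarrow>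
        series_comp (series_comp \<alpha> \<beta>) \<gamma> = series_comp \<alpha> (series_comp \<beta> \<gamma>)) \<and>
     (\<gamma> [] = 0 \<longrightarrow>
        series_comp (series_add \<alpha> \<beta>) \<gamma> = series_add (series_comp \<alpha> \<gamma>) (series_comp \<beta> \<gamma>) \<and>
        series_comp (series_mult scale \<alpha> \<beta>) \<gamma>
          = series_mult scale (series_comp \<alpha> \<gamma>) (series_comp \<beta> \<gamma>)) \<and>
     (series_id \<in> Mul scale \<and>
      series_comp \<alpha> series_id = \<alpha> \<and> (\<alpha> [] = 0 \<longrightarrow> series_comp series_id \<alpha> = \<alpha>)) \<and>
     (\<alpha> [] = 0 \<longrightarrow>
        ((\<exists>\<delta>\<in>Mul scale. \<delta> [] = 0 \<and>
            series_comp \<alpha> \<delta> = series_id \<and> series_comp \<delta> \<alpha> = series_id)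
          \<longleftrightarrow> (\<exists>g\<in>linear_maps scale. (\<lambda>b. snd (\<alpha> [b])) \<circ> g = id \<and>
                                     g \<circ> (\<lambda>b. snd (\<alpha> [b])) = id)))"
proof -
  interpret algebra_over_field scale by fact
  show ?thesis
    using assms(2-)
    by (intro conjI impI series_mult_assoc series_mult_add_left series_mult_add_right
        series_one_mem_Mul series_one_mult mult_invertible_iff series_comp_assoc
        series_comp_add series_comp_mult series_id_mem_Mul series_comp_id_right
        series_comp_id_left comp_invertible_iff)
qed

end
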